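(* Let $n\ge d$, $L=\{\ell_1,\dots,\ell_n\}$, $R=\{r_1,\dots,r_d\}$, and let $\mathcal{M}$ be a linkage $(n,d)$-matching field on $L\sqcup R$. For every $v\in\mathbb{Z}_{>0}^d$ with $v_1+\dots+v_d=n$ there exists a maximal tope with right degree vector $v$ that is compatible with (every matching of) $\mathcal{M}$, and it is the unique tope with right degree vector $v$ compatible with $\mathcal{M}$.
   Context: Graphs are bipartite graphs on $L\sqcup R$ identified with edge sets; the right degree vector is $(\deg r_1,\dots,\deg r_d)$. A maximal tope is a graph in which every node of $L$ has degree exactly $1$ and every node of $R$ has positive degree. Two graphs $F_1,F_2$ are compatible if for all $J\subseteq L$, $I\subseteq R$ such that both contain a perfect matching between $J$ and $I$, these perfect matchings are equal. An $(n,d)$-matching field $\mathcal{M}=(M_\sigma)$ assigns to each $d$-subset $\sigma\subseteq L$ a perfect matching $M_\sigma$ between $\sigma$ and $R$; it is linkage if for every $r_i\in R$ and every $(d+1)$-subset $\tau\subseteq L$ there exist distinct $\ell_j,\ell_{j'}\in\tau$ such that $M_{\tau\setminus\{\ell_j\}}$ and $M_{\tau\setminus\{\ell_{j'}\}}$ agree everywhere except on the edges incident with $r_i$. *)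

theory Defs
  imports Main
begin

text \<open>Left nodes l_1..l_n are encoded as 0..<n, right nodes r_1..r_d as 0..<d.
  A bipartite graph is its edge set, a set of pairs (left node, right node).\<close>

type_synonym bgraph = "(nat \<times> nat) set"

definition Lnodes :: "nat \<Rightarrow> nat set" where "Lnodes n = {0..<n}"
definition Rnodes :: "nat \<Rightarrow> nat set" where "Rnodes d = {0..<d}"

definition is_graph :: "nat \<Rightarrow> nat \<Rightarrow> bgraph \<Rightarrow> bool" where
  "is_graph n d G \<longleftrightarrow> G \<subseteq> Lnodes n \<times> Rnodes d"

definition ldeg :: "bgraph \<Rightarrow> nat \<Rightarrow> nat" where
  "ldeg G l = card {r. (l, r) \<in> G}"

definition rdeg :: "bgraph \<Rightarrow> nat \<Rightarrow> nat" where
  "rdeg G r = card {l. (l, r) \<in> G}"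

definition perfect_matching :: "nat set \<Rightarrow> nat set \<Rightarrow> bgraph \<Rightarrow> bool" where
  "perfect_matching J I P \<longleftrightarrow> P \<subseteq> J \<times> I \<and>
     (\<forall>j\<in>J. \<exists>!i. (j, i) \<in> P) \<and> (\<forall>i\<in>I. \<exists>!j. (j, i) \<in> P)"

definition maximal_tope :: "nat \<Rightarrow> nat \<Rightarrow> bgraph \<Rightarrow> bool" where
  "maximal_tope n d G \<longleftrightarrow> is_graph n d G \<and>
     (\<forall>l\<in>Lnodes n. ldeg G l = 1) \<and> (\<forall>r\<in>Rnodes d. rdeg G r > 0)"

definition compatible :: "nat \<Rightarrow> nat \<Rightarrow> bgraph \<Rightarrow> bgraph \<Rightarrow> bool" where
  "compatible n d F1 F2 \<longleftrightarrow>
     (\<forall>J I P1 P2. J \<subseteq> Lnodes n \<longrightarrow> I \<subseteq> Rnodes d \<longrightarrow>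
        P1 \<subseteq> F1 \<longrightarrow> perfect_matching J I P1 \<longrightarrow>
        P2 \<subseteq> F2 \<longrightarrow> perfect_matching J I P2 \<longrightarrow> P1 = P2)"

definition matching_field :: "nat \<Rightarrow> nat \<Rightarrow> (nat set \<Rightarrow> bgraph) \<Rightarrow> bool" where
  "matching_field n d M \<longleftrightarrow>
     (\<forall>\<sigma>. \<sigma> \<subseteq> Lnodes n \<and> card \<sigma> = d \<longrightarrow> perfect_matching \<sigma> (Rnodes d) (M \<sigma>))"

definition linkage :: "nat \<Rightarrow> nat \<Rightarrow> (nat set \<Rightarrow> bgraph) \<Rightarrow> bool" where
  "linkage n d M \<longleftrightarrow> matching_field n d M \<and>
     (\<forall>i\<in>Rnodes d. \<forall>\<tau>. \<tau> \<subseteq> Lnodes n \<and> card \<tau> = d + 1 \<longrightarrow>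
        (\<exists>j\<in>\<tau>. \<exists>j'\<in>\<tau>. j \<noteq> j' \<and>
           M (\<tau> - {j}) - {e. snd e = i} = M (\<tau> - {j'}) - {e. snd e = i}))"

definition compatible_with_MF :: "nat \<Rightarrow> nat \<Rightarrow> (nat set \<Rightarrow> bgraph) \<Rightarrow> bgraph \<Rightarrow> bool" where
  "compatible_with_MF n d M G \<longleftrightarrow>
     (\<forall>\<sigma>. \<sigma> \<subseteq> Lnodes n \<and> card \<sigma> = d \<longrightarrow> compatible n d G (M \<sigma>))"

end

theory Submission
  imports Defs
begin

text \<open>A tope is a map \<open>f: L \<rightarrow> R\<close>. If it is compatible with the matching field, then every
  transversal \<open>S\<close> of its fibres satisfies \<open>M S = f|S\<close>. Two distinct such maps with the same fibre
  sizes differ along an alternating cycle; extending it to a transversal of one of them contradicts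
  the compatibility of the other. This gives uniqueness.

  For existence, one tope on every set of the appropriate size is grown by raising one entry of the
  degree vector at a time, starting from the matching field. The invariant is that on each set with
  one surplus node the topes fit into a common spanning tree, as the matchings do by linkage. All
  transversals of the resulting map carry matchings of the field, so its compatibility reduces to
  the pairwise compatibility of these matchings. The latter follows by moving one matching towards
  the other by exchanges in linkage trees that keep the common submatching.\<close>

section \<open>Topes on subsets of the left nodes and their rooted extensions\<close>

definition fibre :: "'l set \<Rightarrow> ('l \<Rightarrow> 'r) \<Rightarrow> 'r \<Rightarrow> 'l set" where
  "fibre A f i = {l \<in> A. f l = i}"

text \<open>On a set \<open>T\<close> with one surplus node, \<open>g\<close> is the linkage tree of \<open>T\<close> rooted at \<open>i\<close>: each
  left node is sent to its parent. The fibre over \<open>i\<close> is then the full neighbourhood of \<open>i\<close>.\<close>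

definition extension :: "('r \<Rightarrow> nat) \<Rightarrow> ('l set \<Rightarrow> 'l \<Rightarrow> 'r) \<Rightarrow> 'l set \<Rightarrow> 'r \<Rightarrow> ('l \<Rightarrow> 'r) \<Rightarrow> bool" where
  "extension v f T i g \<longleftrightarrow> card (fibre T g i) = Suc (v i) \<and>
     (\<forall>j\<in>T. \<forall>l\<in>T - {j}. f (T - {j}) l = i \<longrightarrow> g l = i) \<and>
     (\<forall>j\<in>T. g j = i \<longrightarrow> (\<forall>l\<in>T - {j}. f (T - {j}) l = g l))"

text \<open>With all entries of \<open>v\<close> equal to 1 this describes a matching field. The
  second clause is the invariant that keeps the growth going: one rooted map for each choice of
  root.\<close>

definition linked_field :: "'l set \<Rightarrow> 'r set \<Rightarrow> ('r \<Rightarrow> nat) \<Rightarrow> ('l set \<Rightarrow> 'l \<Rightarrow> 'r) \<Rightarrow> bool" where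
  "linked_field L R v f \<longleftrightarrow>
     (\<forall>S\<subseteq>L. card S = sum v R \<longrightarrow> f S ` S \<subseteq> R \<and> (\<forall>i\<in>R. card (fibre S (f S) i) = v i)) \<and>
     (\<forall>T\<subseteq>L. card T = Suc (sum v R) \<longrightarrow> (\<forall>i\<in>R. \<exists>g. extension v f T i g))"

section \<open>Raising one entry: sets with two surplus nodes\<close>

text \<open>Sets of size \<open>k + 1\<close> that pairwise share \<open>k\<close> elements lie in a
  common set of size \<open>k + 2\<close> or form a sunflower with at least three petals. In a
  sunflower, the set indexed by a kernel element \<open>x\<close> would have to contain all petals
  and the rest of the kernel, which is too much.\<close>

lemma near_sunflower:
  fixes F :: "'a \<Rightarrow> 'a set"
  assumes fin: "finite P" and "P \<noteq> {}" and k: "k \<ge> 1"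
    and sub: "\<And>j. j \<in> P \<Longrightarrow> F j \<subseteq> P - {j}"
    and cF: "\<And>j. j \<in> P \<Longrightarrow> card (F j) = Suc k"
    and int: "\<And>a b. a \<in> P \<Longrightarrow> b \<in> P \<Longrightarrow> a \<noteq> b \<Longrightarrow> k \<le> card (F a \<inter> F b)"
  shows "\<exists>W\<subseteq>P. card W = k + 2 \<and> (\<forall>j\<in>P. F j \<subseteq> W)"
proof -
  have finF: "finite (F j)" if "j \<in> P" for j
    using cF[OF that] card.infinite by fastforce
  obtain a where a: "a \<in> P" using assms(2) by blast
  have "F a \<noteq> {}" using cF[OF a] by auto
  then obtain b where b: "b \<in> F a" by blast
  have bP: "b \<in> P" "b \<noteq> a" using sub[OF a] b by auto
  define C where "C = F a \<inter> F b"
  have "F a \<noteq> F b" using b sub[OF bP(1)] by auto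
  have "C \<noteq> F a"
  proof
    assume "C = F a"
    then have "F a \<subseteq> F b" by (auto simp: C_def)
    then show False using \<open>F a \<noteq> F b\<close> card_subset_eq[OF finF[OF bP(1)]] cF a bP by metis
  qed
  then have "C \<subset> F a" by (auto simp: C_def)
  then have "card C < Suc k" using psubset_card_mono[OF finF[OF a]] cF[OF a] by metis
  then have cC: "card C = k" using int[OF a bP(1)] bP(2) by (simp add: C_def)
  have finC: "finite C" using finF[OF a] by (simp add: C_def)
  have "card (F a - C) = 1" "card (F b - C) = 1"
    using card_Diff_subset[OF finC, of "F a"] card_Diff_subset[OF finC, of "F b"] cC cF a bP
    by (auto simp: C_def)
  then obtain a' b' where a': "F a - C = {a'}" and b': "F b - C = {b'}"
    by (auto simp: card_1_singleton_iff)
  have Fa: "F a = insert a' C" and Fb: "F b = insert b' C"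
    using a' b' by (auto simp: C_def)
  have ne: "a' \<noteq> b'" "a' \<notin> C" "b' \<notin> C" using a' b' C_def by auto
  define W where "W = insert a' (insert b' C)"
  have cW: "card W = k + 2" using ne cC finC by (simp add: W_def)
  have "F c \<subseteq> W" if c: "c \<in> P" for c
  proof (rule ccontr)
    assume "\<not> F c \<subseteq> W"
    then obtain w where w: "w \<in> F c" "w \<notin> W" by blast
    have ca: "c \<noteq> a" "c \<noteq> b" using w Fa Fb by (auto simp: W_def)
    have le: "card (F c - {w}) = k" using w(1) cF[OF c] finF[OF c] by simp
    have "F c \<inter> F a = F c - {w}"
      using w Fa le int[OF c a ca(1)] finF[OF c]
      by (intro card_seteq) (auto simp: W_def)
    moreover have "F c \<inter> F b = F c - {w}"
      using w Fb le int[OF c bP(1) ca(2)] finF[OF c]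
      by (intro card_seteq) (auto simp: W_def)
    ultimately have "F c - {w} \<subseteq> C" by (auto simp: C_def)
    then have "F c - {w} = C" using card_subset_eq[OF finC] le cC by metis
    then have Fc: "F c = insert w C" using w by blast
    \<comment> \<open>Kernel elements are themselves indices; \<open>k \<ge> 1\<close> provides
      one.\<close>
    obtain x where x: "x \<in> C" using cC k by fastforce
    have xP: "x \<in> P" using x sub[OF a] by (auto simp: C_def)
    have xx: "x \<notin> F x" using sub[OF xP] by auto
    \<comment> \<open>\<open>F x\<close> omits \<open>x\<close>, so its \<open>k\<close> common
      elements with a set \<open>insert z C\<close> must be all of \<open>C - {x}\<close> and the
      petal \<open>z\<close>.\<close>
    have key: "z \<in> F x \<and> C - {x} \<subseteq> F x" if "y \<in> P" "F y = insert z C" for y z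
    proof -
      have "x \<noteq> y" using that x sub[of y] by auto
      then have "k \<le> card (F x \<inter> F y)" using int[OF xP that(1)] by simp
      moreover have s: "F x \<inter> F y \<subseteq> insert z (C - {x})" using that xx by auto
      moreover have "card (insert z (C - {x})) \<le> k"
        using card_insert_le_m1[of k "C - {x}" z] x cC k finC by simp
      ultimately have "F x \<inter> F y = insert z (C - {x})"
        using finC by (intro card_seteq) auto
      then show ?thesis by auto
    qed
    have "insert a' (insert b' (insert w (C - {x}))) \<subseteq> F x"
      using key[OF a Fa] key[OF bP(1) Fb] key[OF c Fc] by auto
    then have "card (insert a' (insert b' (insert w (C - {x})))) \<le> Suc k"
      using card_mono[OF finF[OF xP]] cF[OF xP] by metis
    moreover have "card (insert a' (insert b' (insert w (C - {x})))) = Suc (Suc (Suc (k - 1)))"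
      using ne w(2) x finC cC by (auto simp: W_def card_insert_if)
    ultimately show False using k by simp
  qed
  moreover have "W \<subseteq> P" using sub[OF a] sub[OF bP(1)] Fa Fb by (auto simp: W_def)
  ultimately show ?thesis using cW by blast
qed

text \<open>\<open>P\<close> has two surplus nodes; \<open>h a b\<close> is the map on \<open>P - {a, b}\<close> and \<open>G i a\<close> the linkage tree
  of \<open>P - {a}\<close> rooted at \<open>i\<close>. The new field consists of the maps \<open>G k a\<close>.\<close>

locale two_step =
  fixes P :: "'l set" and R :: "'r set" and v :: "'r \<Rightarrow> nat"
    and h :: "'l \<Rightarrow> 'l \<Rightarrow> 'l \<Rightarrow> 'r" and G :: "'r \<Rightarrow> 'l \<Rightarrow> 'l \<Rightarrow> 'r"
  assumes fin: "finite P" and ne: "P \<noteq> {}"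
    and pos: "i \<in> R \<Longrightarrow> v i \<ge> 1"
    and sym: "h a b = h b a"
    and card_h: "\<lbrakk>i \<in> R; a \<in> P; b \<in> P; a \<noteq> b\<rbrakk> \<Longrightarrow> card (fibre (P - {a} - {b}) (h a b) i) = v i"
    and card_G: "\<lbrakk>i \<in> R; a \<in> P\<rbrakk> \<Longrightarrow> card (fibre (P - {a}) (G i a) i) = Suc (v i)"
    and grow: "\<lbrakk>i \<in> R; a \<in> P; b \<in> P; a \<noteq> b; l \<in> P; l \<noteq> a; l \<noteq> b; h a b l = i\<rbrakk> \<Longrightarrow> G i a l = i"
    and restr: "\<lbrakk>i \<in> R; a \<in> P; b \<in> P; a \<noteq> b; G i a b = i; l \<in> P; l \<noteq> a; l \<noteq> b\<rbrakk> \<Longrightarrow> h a b l = G i a l"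
begin

definition "F i a = fibre (P - {a}) (G i a) i"

lemma F_iff: "l \<in> F i a \<longleftrightarrow> l \<in> P \<and> l \<noteq> a \<and> G i a l = i"
  by (auto simp: F_def fibre_def)

lemma finite_F: "finite (F i a)"
  using fin by (auto simp: F_def fibre_def)

lemma card_F: "\<lbrakk>i \<in> R; a \<in> P\<rbrakk> \<Longrightarrow> card (F i a) = Suc (v i)"
  using card_G by (simp add: F_def)

text \<open>The fibres of \<open>G i a\<close> and \<open>G i b\<close> over \<open>i\<close> both
  contain that of \<open>h a b\<close>, which has \<open>v i\<close> elements, so
  \<open>near_sunflower\<close> applies. For a root \<open>j\<close> in \<open>W\<close>, counting
  forces the fibre to be \<open>W - {j}\<close>.\<close>

lemma F_cover:
  assumes i: "i \<in> R"
  obtains W where "W \<subseteq> P" "card W = v i + 2" "\<And>j. j \<in> P \<Longrightarrow> F i j \<subseteq> W"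
    "\<And>j l. \<lbrakk>j \<in> W; l \<in> P; l \<noteq> j\<rbrakk> \<Longrightarrow> G i j l = i \<longleftrightarrow> l \<in> W"
proof -
  have int: "v i \<le> card (F i a \<inter> F i b)" if "a \<in> P" "b \<in> P" "a \<noteq> b" for a b
  proof -
    have "fibre (P - {a} - {b}) (h a b) i \<subseteq> F i a \<inter> F i b"
    proof
      fix l assume "l \<in> fibre (P - {a} - {b}) (h a b) i"
      then have l: "l \<in> P" "l \<noteq> a" "l \<noteq> b" "h a b l = i" by (auto simp: fibre_def)
      then show "l \<in> F i a \<inter> F i b"
        using grow[OF i that l] grow[OF i that(2,1) that(3)[symmetric] l(1,3,2)] sym[of a b]
        by (auto simp: F_iff)
    qed
    then show ?thesis using card_h[OF i that] card_mono finite_F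
      by (metis finite_Int)
  qed
  obtain W where W: "W \<subseteq> P" "card W = v i + 2" "\<forall>j\<in>P. F i j \<subseteq> W"
    using near_sunflower[OF fin ne pos[OF i], of "F i"] int card_F[OF i]
    by (auto simp: F_iff subset_iff)
  have "F i j = W - {j}" if "j \<in> W" for j
  proof (rule card_subset_eq)
    show "finite (W - {j})" using W fin finite_subset by blast
    have j: "j \<in> P" using that W by auto
    show "F i j \<subseteq> W - {j}" using W j by (auto simp: F_iff)
    show "card (F i j) = card (W - {j})" using card_F[OF i j] W that fin
      by (simp add: finite_subset)
  qed
  then have "G i j l = i \<longleftrightarrow> l \<in> W" if "j \<in> W" "l \<in> P" "l \<noteq> j" for j l
    using that F_iff[of l i j] by blast
  then show ?thesis using W that by blast
qed

text \<open>All of \<open>W\<close> is sent to \<open>k\<close>; elsewhere \<open>g\<close> copies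
  \<open>G k w\<close>. The choice of \<open>w\<close> in \<open>W\<close> does not matter, because
  \<open>G k w\<close> and \<open>G k j\<close> both restrict to \<open>h w j\<close>.\<close>

lemma same_extension:
  assumes k: "k \<in> R"
  shows "\<exists>g. card (fibre P g k) = v k + 2 \<and>
    (\<forall>j\<in>P. \<forall>l\<in>P - {j}. G k j l = k \<longrightarrow> g l = k) \<and>
    (\<forall>j\<in>P. g j = k \<longrightarrow> (\<forall>l\<in>P - {j}. G k j l = g l))"
proof -
  obtain W where W: "W \<subseteq> P" "card W = v k + 2" "\<And>j. j \<in> P \<Longrightarrow> F k j \<subseteq> W"
    "\<And>j l. \<lbrakk>j \<in> W; l \<in> P; l \<noteq> j\<rbrakk> \<Longrightarrow> G k j l = k \<longleftrightarrow> l \<in> W"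
    using F_cover[OF k] by metis
  obtain w where w: "w \<in> W" using W(2) by fastforce
  define g where "g l = (if l \<in> W then k else G k w l)" for l
  have g_k: "g l = k \<longleftrightarrow> l \<in> W" if "l \<in> P" for l
    using W(4)[OF w that] w by (auto simp: g_def)
  have "fibre P g k = W" using g_k W(1) by (auto simp: fibre_def)
  moreover have "g l = k" if "j \<in> P" "l \<in> P - {j}" "G k j l = k" for j l
    using W(3)[OF that(1)] F_iff[of l k j] that g_k[of l] by blast
  moreover have "G k j l = g l" if j: "j \<in> P" "g j = k" and l: "l \<in> P - {j}" for j l
  proof -
    have jW: "j \<in> W" using j g_k by simp
    have lP: "l \<in> P" "l \<noteq> j" using l by auto
    consider "l \<in> W" | "l \<notin> W" "j = w" | "l \<notin> W" "w \<noteq> j" by blast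
    then show ?thesis
    proof cases
      case 1
      then show ?thesis using W(4)[OF jW lP] by (simp add: g_def)
    next
      case 2
      then show ?thesis by (simp add: g_def)
    next
      case 3
      have lw: "l \<noteq> w" using w 3 by auto
      have wP: "w \<in> P" using w W(1) by auto
      have "h w j l = G k w l"
        using restr[OF k wP j(1) 3(2) _ lP(1) lw lP(2)] W(4)[OF w j(1)] jW 3 by auto
      moreover have "h j w l = G k j l"
        using restr[OF k j(1) wP 3(2)[symmetric] _ lP(1) lP(2) lw] W(4)[OF jW wP] w 3 by auto
      ultimately show ?thesis using sym[of w j] 3 by (simp add: g_def)
    qed
  qed
  ultimately show ?thesis using W(2) by (intro exI[of _ g]) auto
qed

text \<open>A node \<open>y0\<close> is split off and hung back on \<open>k\<close>, and
  \<open>G i y0\<close> is used for the rest. For \<open>j\<close> over \<open>i\<close>, both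
  \<open>G k j\<close> and \<open>g\<close> restrict to \<open>h j y0\<close>. For arbitrary
  \<open>j\<close>, the fibres of \<open>G k j\<close> and \<open>g\<close> over \<open>k\<close>
  share a node \<open>y\<close>, and \<open>G i y\<close> has the same fibre over \<open>i\<close>
  for every \<open>y\<close> that \<open>g\<close> sends to \<open>k\<close>.\<close>

lemma other_extension:
  assumes k: "k \<in> R" and i: "i \<in> R" and ik: "i \<noteq> k"
  shows "\<exists>g. card (fibre P g i) = Suc (v i) \<and>
    (\<forall>j\<in>P. \<forall>l\<in>P - {j}. G k j l = i \<longrightarrow> g l = i) \<and>
    (\<forall>j\<in>P. g j = i \<longrightarrow> (\<forall>l\<in>P - {j}. G k j l = g l))"
proof -
  obtain W where W: "W \<subseteq> P" "card W = v i + 2" "\<And>j. j \<in> P \<Longrightarrow> F i j \<subseteq> W"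
    "\<And>j l. \<lbrakk>j \<in> W; l \<in> P; l \<noteq> j\<rbrakk> \<Longrightarrow> G i j l = i \<longleftrightarrow> l \<in> W"
    using F_cover[OF i] by metis
  obtain V where V: "V \<subseteq> P" "card V = v k + 2" "\<And>j. j \<in> P \<Longrightarrow> F k j \<subseteq> V"
    using F_cover[OF k] by metis
  have hG: "h j j' l = G i j l" if "j \<in> W" "j' \<in> W" "j \<noteq> j'" "l \<in> P" "l \<noteq> j" "l \<noteq> j'" for j j' l
    using restr[OF i _ _ that(3) _ that(4,5,6)] that(1,2,3) W(1) W(4)[OF that(1), of j'] by auto
  have "\<exists>a b. a \<in> W \<and> b \<in> W \<and> a \<noteq> b"
  proof -
    have "\<not> card W \<le> 1" using W(2) by simp
    then show ?thesis using card_le_Suc0_iff_eq[of W] W(1) fin finite_subset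
      by (metis One_nat_def)
  qed
  then obtain a b where ab: "a \<in> W" "b \<in> W" "a \<noteq> b" by blast
  have abP: "a \<in> P" "b \<in> P" using ab W(1) by auto
  \<comment> \<open>\<open>y0\<close> lies over \<open>k\<close> once two nodes of \<open>W\<close>
    are removed. Each \<open>j\<close> in \<open>W\<close> differs from one of these two, so
    \<open>grow\<close> will put \<open>y0\<close> over \<open>k\<close> in every such
    \<open>G k j\<close>.\<close>
  have "fibre (P - {a} - {b}) (h a b) k \<noteq> {}"
    using card_h[OF k abP ab(3)] pos[OF k] by auto
  then obtain y0 where y0: "y0 \<in> P" "y0 \<noteq> a" "y0 \<noteq> b" "h a b y0 = k" by (auto simp: fibre_def)
  have Ga: "G i a y0 = k" "G i b y0 = k"
    using hG[OF ab y0(1,2,3)] hG[OF ab(2,1) ab(3)[symmetric] y0(1,3,2)] y0(4) sym[of a b]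
    by metis+
  have y0W: "y0 \<notin> W" using W(4)[OF ab(1) y0(1,2)] Ga ik by auto
  have y0F: "y0 \<in> F k j" if j: "j \<in> W" for j
  proof -
    have jy: "y0 \<noteq> j" using j y0W by auto
    obtain j' where j': "j' \<in> W" "j' \<noteq> j" "G i j' y0 = k"
      using ab Ga by (cases "j = a") auto
    have jP: "j \<in> P" "j' \<in> P" "y0 \<noteq> j'" using j j'(1) W(1) y0W by auto
    have "h j' j y0 = k" using hG[OF j'(1) j j'(2) y0(1) jP(3) jy] j'(3) by simp
    then have "h j j' y0 = k" by (simp add: sym)
    then show ?thesis using grow[OF k jP(1,2) j'(2)[symmetric] y0(1) jy jP(3)] y0(1) jy
      by (simp add: F_iff)
  qed
  define g where "g = (G i y0)(y0 := k)"
  have g_i: "g l = i \<longleftrightarrow> l \<in> F i y0" if "l \<in> P" for l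
    using that ik by (auto simp: g_def F_iff)
  have FW: "F i y0 \<subseteq> W" using W(3) y0 by auto
  have agree: "G k j l = g l" if j: "j \<in> F i y0" and l: "l \<in> P" "l \<noteq> j" for j l
  proof (cases "l = y0")
    case True
    then show ?thesis using y0F[of j] j FW by (auto simp: F_iff g_def)
  next
    case False
    have jP: "j \<in> P" "j \<noteq> y0" "G i y0 j = i" using j by (auto simp: F_iff)
    have "h j y0 l = G k j l"
      using restr[OF k jP(1) y0(1) jP(2) _ l False] y0F[of j] j FW by (auto simp: F_iff)
    moreover have "h y0 j l = G i y0 l"
      using restr[OF i y0(1) jP(1) jP(2)[symmetric] jP(3) l(1) False l(2)] .
    ultimately show ?thesis using sym[of j y0] False by (simp add: g_def)
  qed
  \<comment> \<open>Every \<open>l\<close> in \<open>F i y0\<close> needs a companion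
    \<open>j \<noteq> l\<close> there when \<open>FiK\<close> is shown.\<close>
  have "\<exists>c d. c \<in> F i y0 \<and> d \<in> F i y0 \<and> c \<noteq> d"
  proof -
    have "\<not> card (F i y0) \<le> 1" using card_F[OF i y0(1)] pos[OF i] by simp
    then show ?thesis using card_le_Suc0_iff_eq[OF finite_F] by (metis One_nat_def)
  qed
  then obtain c d where cd: "c \<in> F i y0" "d \<in> F i y0" "c \<noteq> d" by blast
  define K where "K = fibre P g k"
  have K: "K = F k j" if "j \<in> F i y0" for j
  proof -
    have "g j = i" using that g_i by (auto simp: F_iff)
    then have "x \<in> K \<longleftrightarrow> x \<in> F k j" for x
      using agree[OF that, of x] ik by (cases "x = j") (auto simp: K_def fibre_def F_iff)
    then show ?thesis by blast
  qed
  have FiK: "F i y = F i y0" if y: "y \<in> K" for y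
  proof -
    have yP: "y \<in> P" "g y = k" using y by (auto simp: K_def fibre_def)
    have "l \<in> F i y" if j: "j \<in> F i y0" and l: "l \<in> F i y0" "l \<noteq> j" for j l
    proof -
      have lP: "l \<in> P" "j \<in> P" "y \<noteq> j" "l \<noteq> y" "y \<in> F k j"
        using j l yP g_i[of l] g_i[of j] ik y K[OF j] by (auto simp: F_iff)
      have "h j y l = G k j l" using restr[OF k lP(2) yP(1), of l] lP l by (auto simp: F_iff)
      also have "\<dots> = i" using agree[OF j lP(1) l(2)] g_i[OF lP(1)] l by simp
      finally have "h y j l = i" by (simp add: sym)
      then show ?thesis using grow[OF i yP(1) lP(2,3) lP(1,4) l(2)] lP by (auto simp: F_iff)
    qed
    then have "F i y0 \<subseteq> F i y" using cd by (metis subsetI)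
    then show ?thesis using card_subset_eq[OF finite_F] card_F[OF i] yP y0 by metis
  qed
  have "g l = i" if j: "j \<in> P" and l: "l \<in> P - {j}" "G k j l = i" for j l
  proof -
    \<comment> \<open>Both sets have \<open>v k + 1\<close> elements inside \<open>V\<close>, which
      has \<open>v k + 2\<close>; they meet because \<open>v k \<ge> 1\<close>.\<close>
    have "K \<inter> F k j \<noteq> {}"
    proof
      assume "K \<inter> F k j = {}"
      then have "card (K \<union> F k j) = card K + card (F k j)"
        using K[OF cd(1)] finite_F by (intro card_Un_disjoint) auto
      also have "\<dots> = 2 * v k + 2"
        using K[OF cd(1)] card_F[OF k] cd(1) j by (simp add: F_iff)
      finally have "card (K \<union> F k j) = 2 * v k + 2" .
      moreover have "K \<union> F k j \<subseteq> V" using V(3) K[OF cd(1)] cd(1) j by (auto simp: F_iff)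
      then have "card (K \<union> F k j) \<le> v k + 2"
        using card_mono V(1,2) fin finite_subset by metis
      ultimately show False using pos[OF k] by simp
    qed
    then obtain y where y: "y \<in> K" "y \<in> F k j" by blast
    have yP: "y \<in> P" "j \<noteq> y" "G k j y = k" using y by (auto simp: F_iff)
    have ly: "l \<noteq> y" using l yP ik by auto
    have "h j y l = i" using restr[OF k j yP(1,2,3), of l] l ly by auto
    then have "h y j l = i" by (simp add: sym)
    then have "l \<in> F i y" using grow[OF i yP(1) j yP(2)[symmetric], of l] l ly by (auto simp: F_iff)
    then show ?thesis using FiK[OF y(1)] g_i l by auto
  qed
  moreover have "x \<in> fibre P g i \<longleftrightarrow> x \<in> F i y0" for x
    using g_i[of x] F_iff[of x i y0] by (auto simp: fibre_def)
  then have "fibre P g i = F i y0" by blast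
  then have "card (fibre P g i) = Suc (v i)" using card_F[OF i y0(1)] by simp
  moreover have "G k j l = g l" if "j \<in> P" "g j = i" "l \<in> P - {j}" for j l
    using agree[of j l] g_i that by auto
  ultimately show ?thesis by (intro exI[of _ g]) blast
qed

end

section \<open>Induction over the degree vector\<close>

lemma linked_field_cong:
  assumes "\<And>i. i \<in> R \<Longrightarrow> v i = w i" and "linked_field L R v f"
  shows "linked_field L R w f"
proof -
  have "sum v R = sum w R" using assms(1) by (rule sum.cong[OF refl])
  then show ?thesis using assms unfolding linked_field_def extension_def by simp
qed

text \<open>The new maps are the old extensions rooted at \<open>k\<close>. Removing a node over
  \<open>k\<close> gives back an old map, so the other fibres keep their sizes; the new extensions
  come from \<open>two_step\<close>. The second conclusion serves to carry transversals through the
  induction.\<close>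

lemma linked_field_step:
  assumes finL: "finite L" and finR: "finite R" and lf: "linked_field L R v f"
    and pos: "\<And>i. i \<in> R \<Longrightarrow> v i \<ge> 1" and k: "k \<in> R"
  shows "\<exists>f'. linked_field L R (v(k := Suc (v k))) f' \<and>
    (\<forall>T\<subseteq>L. card T = Suc (sum v R) \<longrightarrow> extension v f T k (f' T))"
proof -
  define v' where "v' = v(k := Suc (v k))"
  have sum': "sum v' R = Suc (sum v R)"
  proof -
    have "sum v' (R - {k}) = sum v (R - {k})" by (rule sum.cong) (auto simp: v'_def)
    then show ?thesis
      using sum.remove[OF finR k, of v'] sum.remove[OF finR k, of v] by (simp add: v'_def)
  qed
  have tope: "f S ` S \<subseteq> R" "\<And>i. i \<in> R \<Longrightarrow> card (fibre S (f S) i) = v i"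
    if "S \<subseteq> L" "card S = sum v R" for S
    using lf that unfolding linked_field_def by blast+
  define g where "g i T = (SOME h. extension v f T i h)" for i T
  have g: "extension v f T i (g i T)" if "T \<subseteq> L" "card T = Suc (sum v R)" "i \<in> R" for i T
  proof -
    have "\<exists>h. extension v f T i h" using lf that unfolding linked_field_def by simp
    then show ?thesis unfolding g_def by (rule someI_ex)
  qed
  have card_g: "card (fibre T (g i T) i) = Suc (v i)"
    and grow_g: "\<And>j l. \<lbrakk>j \<in> T; l \<in> T; l \<noteq> j; f (T - {j}) l = i\<rbrakk> \<Longrightarrow> g i T l = i"
    and restr_g: "\<And>j l. \<lbrakk>j \<in> T; g i T j = i; l \<in> T; l \<noteq> j\<rbrakk> \<Longrightarrow> f (T - {j}) l = g i T l"
    if "T \<subseteq> L" "card T = Suc (sum v R)" "i \<in> R" for i T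
    using g[OF that] unfolding extension_def by simp_all
  have topes: "g k S ` S \<subseteq> R \<and> (\<forall>i\<in>R. card (fibre S (g k S) i) = v' i)"
    if S: "S \<subseteq> L" "card S = sum v' R" for S
  proof -
    note S' = S(1) S(2)[unfolded sum'] k
    have "fibre S (g k S) k \<noteq> {}" using card_g[OF S'] by auto
    then obtain j where j: "j \<in> S" "g k S j = k" by (auto simp: fibre_def)
    have eq: "f (S - {j}) l = g k S l" if "l \<in> S - {j}" for l
      using restr_g[OF S' j, of l] that by auto
    have Sj: "S - {j} \<subseteq> L" "card (S - {j}) = sum v R" using S S' j by auto
    have "g k S l \<in> R" if "l \<in> S" for l
      using tope(1)[OF Sj] eq[of l] j k that by (cases "l = j") auto
    moreover have "card (fibre S (g k S) i) = v' i" if i: "i \<in> R" for i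
    proof (cases "i = k")
      case True
      then show ?thesis using card_g[OF S'] by (simp add: v'_def)
    next
      case False
      have "fibre S (g k S) i = fibre (S - {j}) (f (S - {j})) i"
        using eq j False by (auto simp: fibre_def)
      then show ?thesis using tope(2)[OF Sj i] False by (simp add: v'_def)
    qed
    ultimately show ?thesis by auto
  qed
  have exts: "\<exists>h. extension v' (g k) P i h"
    if P: "P \<subseteq> L" "card P = Suc (sum v' R)" and i: "i \<in> R" for P i
  proof -
    have finP: "finite P" using P(1) finL finite_subset by blast
    have P1: "P - {a} \<subseteq> L" "card (P - {a}) = Suc (sum v R)" if "a \<in> P" for a
      using P sum' that by auto
    have P2: "P - {a} - {b} \<subseteq> L" "card (P - {a} - {b}) = sum v R"
      if "a \<in> P" "b \<in> P" "a \<noteq> b" for a b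
      using P1[OF that(1)] that by auto
    interpret two_step P R v "\<lambda>a b. f (P - {a} - {b})" "\<lambda>i a. g i (P - {a})"
    proof
      show "finite P" by (rule finP)
      show "P \<noteq> {}" using P(2) by auto
      show "1 \<le> v i" if "i \<in> R" for i using pos that .
      show "f (P - {a} - {b}) = f (P - {b} - {a})" for a b
        by (rule arg_cong[of _ _ f]) blast
      show "card (fibre (P - {a} - {b}) (f (P - {a} - {b})) i) = v i"
        if "i \<in> R" "a \<in> P" "b \<in> P" "a \<noteq> b" for i a b
        using tope(2)[OF P2] that by blast
      show "card (fibre (P - {a}) (g i (P - {a})) i) = Suc (v i)" if "i \<in> R" "a \<in> P" for i a
        using card_g[OF P1] that by blast
      show "g i (P - {a}) l = i"
        if "i \<in> R" "a \<in> P" "b \<in> P" "a \<noteq> b" "l \<in> P" "l \<noteq> a" "l \<noteq> b" "f (P - {a} - {b}) l = i"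
        for i a b l
        using grow_g[OF P1[OF that(2)] that(1), of b l] that by auto
      show "f (P - {a} - {b}) l = g i (P - {a}) l"
        if "i \<in> R" "a \<in> P" "b \<in> P" "a \<noteq> b" "g i (P - {a}) b = i" "l \<in> P" "l \<noteq> a" "l \<noteq> b"
        for i a b l
        using restr_g[OF P1[OF that(2)] that(1), of b l] that by auto
    qed
    show ?thesis
    proof (cases "i = k")
      case True
      then show ?thesis using same_extension[OF k] unfolding extension_def by (simp add: v'_def)
    next
      case False
      then show ?thesis using other_extension[OF k i False] unfolding extension_def
        by (simp add: v'_def)
    qed
  qed
  have "linked_field L R v' (g k)" unfolding linked_field_def using topes exts by simp
  then show ?thesis using g[OF _ _ k] unfolding v'_def by (intro exI[of _ "g k"]) simp
qed

text \<open>Transversals are inherited because the fibre of \<open>f' T\<close> over the raised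
  entry \<open>k\<close> has at least two nodes. A set \<open>S\<close> on which \<open>f' T\<close>
  is injective misses one of them, and dropping that node leads back to the map of the smaller
  field.\<close>

lemma linked_field_exists:
  assumes finL: "finite L" and finR: "finite R" and base: "linked_field L R (\<lambda>_. 1) m"
    and "\<And>i. i \<in> R \<Longrightarrow> v i \<ge> 1"
  shows "\<exists>f. linked_field L R v f \<and> (\<forall>T\<subseteq>L. card T = sum v R \<longrightarrow>
    (\<forall>S\<subseteq>T. card S = card R \<longrightarrow> inj_on (f T) S \<longrightarrow> (\<forall>l\<in>S. m S l = f T l)))"
  using assms(4)
proof (induction "sum v R" arbitrary: v rule: less_induct)
  case less
  show ?case
  proof (cases "\<forall>i\<in>R. v i = 1")
    case True
    then have "linked_field L R v m" using linked_field_cong[OF _ base, of v] by simp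
    \<comment> \<open>All entries are 1, so \<open>T\<close> has only \<open>card R\<close>
      nodes.\<close>
    moreover have "S = T" if "T \<subseteq> L" "card T = sum v R" "S \<subseteq> T" "card S = card R" for S T
      using that True finL by (simp add: card_subset_eq finite_subset)
    ultimately show ?thesis by blast
  next
    case False
    then obtain k where k: "k \<in> R" "v k \<noteq> 1" by blast
    then have k2: "v k \<ge> 2" using less.prems[of k] by simp
    define u where "u = v(k := v k - 1)"
    have v: "v = u(k := Suc (u k))" using k2 by (auto simp: u_def)
    have pos: "u i \<ge> 1" if "i \<in> R" for i using less.prems[OF that] k2 by (auto simp: u_def)
    have sumv: "sum v R = Suc (sum u R)"
      using sum.remove[OF finR k(1), of v] sum.remove[OF finR k(1), of u]
        sum.cong[OF refl, of "R - {k}" v u] k2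
      by (auto simp: u_def)
    obtain f where f: "linked_field L R u f"
      and trans: "\<And>T S l. \<lbrakk>T \<subseteq> L; card T = sum u R; S \<subseteq> T; card S = card R; inj_on (f T) S; l \<in> S\<rbrakk>
        \<Longrightarrow> m S l = f T l"
      using less.hyps[of u] sumv pos by (metis lessI)
    obtain f' where f': "linked_field L R v f'"
      and ext: "\<And>T. \<lbrakk>T \<subseteq> L; card T = Suc (sum u R)\<rbrakk> \<Longrightarrow> extension u f T k (f' T)"
      using linked_field_step[OF finL finR f pos k(1)] v by auto
    have "m S l = f' T l"
      if T: "T \<subseteq> L" "card T = sum v R" and S: "S \<subseteq> T" "card S = card R" "inj_on (f' T) S" "l \<in> S"
      for T S l
    proof -
      have e: "card (fibre T (f' T) k) = Suc (u k)"
        "\<And>j l. \<lbrakk>j \<in> T; f' T j = k; l \<in> T; l \<noteq> j\<rbrakk> \<Longrightarrow> f (T - {j}) l = f' T l"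
        using ext[OF T(1)] T(2) sumv unfolding extension_def by auto
      have "\<not> fibre T (f' T) k \<subseteq> S"
      proof
        assume sub: "fibre T (f' T) k \<subseteq> S"
        then have "inj_on (f' T) (fibre T (f' T) k)" using S(3) inj_on_subset by blast
        then have "card (fibre T (f' T) k) = card (f' T ` fibre T (f' T) k)"
          by (simp add: card_image)
        also have "\<dots> \<le> card {k}" by (intro card_mono) (auto simp: fibre_def)
        finally show False using e(1) pos[OF k(1)] by simp
      qed
      then obtain j where j: "j \<in> T" "f' T j = k" "j \<notin> S" by (auto simp: fibre_def)
      have eq: "f (T - {j}) x = f' T x" if "x \<in> S" for x
        using e(2)[OF j(1,2), of x] that S(1) j(3) by auto
      have "inj_on (f (T - {j})) S" using S(3) eq by (simp cong: inj_on_cong)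
      then have "m S l = f (T - {j}) l"
        using trans[of "T - {j}" S l] T S j sumv by auto
      then show ?thesis using eq S(4) by simp
    qed
    then show ?thesis using f' by blast
  qed
qed

section \<open>Linkage trees on sets with one surplus node\<close>

text \<open>\<open>p y\<close> is the matching on \<open>T - {y}\<close>. The pairs
  \<open>a i\<close>, \<open>b i\<close> supplied by linkage are the edges of a graph on
  \<open>T\<close>, one for each right node. There is one edge less than there are nodes, so
  connectedness will make it a tree.\<close>

locale linkage_graph =
  fixes T :: "'l set" and R :: "'r set" and p :: "'l \<Rightarrow> 'l \<Rightarrow> 'r" and a b :: "'r \<Rightarrow> 'l"
  assumes finT: "finite T" and finR: "finite R" and cardT: "card T = Suc (card R)"
    and bij: "y \<in> T \<Longrightarrow> bij_betw (p y) (T - {y}) R"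
    and ends: "i \<in> R \<Longrightarrow> a i \<in> T" "i \<in> R \<Longrightarrow> b i \<in> T" "i \<in> R \<Longrightarrow> a i \<noteq> b i"
    and labels: "i \<in> R \<Longrightarrow> p (a i) (b i) = i" "i \<in> R \<Longrightarrow> p (b i) (a i) = i"
    and agree: "\<lbrakk>i \<in> R; l \<in> T; l \<noteq> a i; l \<noteq> b i\<rbrakk> \<Longrightarrow> p (a i) l = p (b i) l"
begin

text \<open>These sets are the unions of connected components of the graph with edges
  \<open>a i\<close>, \<open>b i\<close>.\<close>

definition closed where
  "closed S \<longleftrightarrow> S \<subseteq> T \<and> (\<forall>i\<in>R. a i \<in> S \<longleftrightarrow> b i \<in> S)"

text \<open>Moving the omitted node along an edge \<open>i' \<noteq> i\<close> only swaps which end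
  carries the label \<open>i'\<close>, so it cannot affect where \<open>i\<close> occurs. Both ends
  of edge \<open>i\<close> itself qualify by \<open>labels\<close>.\<close>

lemma hits_closed:
  assumes i: "i \<in> R" and S: "closed S"
  shows "closed {y \<in> S. \<exists>l. (l = a i \<or> l = b i) \<and> l \<noteq> y \<and> p y l = i}" (is "closed ?H")
proof -
  have E: "\<exists>l. (l = a i \<or> l = b i) \<and> l \<noteq> a i \<and> p (a i) l = i"
    "\<exists>l. (l = a i \<or> l = b i) \<and> l \<noteq> b i \<and> p (b i) l = i"
    using ends(3)[OF i] labels[OF i] by metis+
  have "a i' \<in> ?H \<longleftrightarrow> b i' \<in> ?H" if i': "i' \<in> R" for i'
  proof (cases "i' = i")
    case True
    then show ?thesis using S i E by (simp add: closed_def)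
  next
    case False
    have "(l \<noteq> a i' \<and> p (a i') l = i) \<longleftrightarrow> (l \<noteq> b i' \<and> p (b i') l = i)"
      if "l = a i \<or> l = b i" for l
    proof -
      have "l \<in> T" using that ends(1,2)[OF i] by blast
      then show ?thesis
        using agree[OF i', of l] labels[OF i'] False by (metis (full_types))
    qed
    then have "(\<exists>l. (l = a i \<or> l = b i) \<and> l \<noteq> a i' \<and> p (a i') l = i) \<longleftrightarrow>
      (\<exists>l. (l = a i \<or> l = b i) \<and> l \<noteq> b i' \<and> p (b i') l = i)" by blast
    then show ?thesis using S i' by (simp add: closed_def)
  qed
  then show ?thesis using S unfolding closed_def by blast
qed

text \<open>If \<open>S\<close> splits into smaller closed sets, the bounds add up. If it is
  minimal, \<open>hits_closed\<close> gives all of \<open>S\<close>, so for any \<open>y\<close> in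
  \<open>S\<close> the matching \<open>p y\<close> places every label of an edge inside
  \<open>S\<close> on a node of \<open>S - {y}\<close>.\<close>

lemma closed_few_labels:
  assumes "closed S" and "S \<noteq> {}"
  shows "card {i \<in> R. a i \<in> S} < card S"
  using assms
proof (induction "card S" arbitrary: S rule: less_induct)
  case less
  have finS: "finite S" using less.prems finT finite_subset by (auto simp: closed_def)
  show ?case
  proof (cases "\<exists>S1. closed S1 \<and> S1 \<subset> S \<and> S1 \<noteq> {}")
    case True
    then obtain S1 where S1: "closed S1" "S1 \<subset> S" "S1 \<noteq> {}" by blast
    define S2 where "S2 = S - S1"
    have S2: "closed S2" "S2 \<subset> S" "S2 \<noteq> {}"
      using less.prems S1 by (auto simp: closed_def S2_def)
    have "card {i \<in> R. a i \<in> S1} < card S1" "card {i \<in> R. a i \<in> S2} < card S2"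
      using less.hyps[OF _ S1(1,3)] less.hyps[OF _ S2(1,3)] S1 S2 finS psubset_card_mono by auto
    moreover have "{i \<in> R. a i \<in> S} = {i \<in> R. a i \<in> S1} \<union> {i \<in> R. a i \<in> S2}"
      using S1 by (auto simp: S2_def)
    then have "card {i \<in> R. a i \<in> S} \<le> card {i \<in> R. a i \<in> S1} + card {i \<in> R. a i \<in> S2}"
      by (simp add: card_Un_le)
    moreover have "card S = card S1 + card S2"
      unfolding S2_def using S1(2) finS
      by (metis card_Diff_subset card_mono finite_subset le_add_diff_inverse psubset_imp_subset)
    ultimately show ?thesis by linarith
  next
    case False
    obtain y where y: "y \<in> S" using less.prems by blast
    have yT: "y \<in> T" using y less.prems by (auto simp: closed_def)
    have ex: "\<exists>l\<in>S - {y}. p y l = i" if i: "i \<in> R" "a i \<in> S" for i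
    proof -
      let ?H = "{z \<in> S. \<exists>l. (l = a i \<or> l = b i) \<and> l \<noteq> z \<and> p z l = i}"
      have "a i \<in> ?H" using i ends labels by force
      then have "?H = S" using False hits_closed[OF i(1) less.prems(1)] by blast
      then show ?thesis using y i less.prems by (auto simp: closed_def)
    qed
    then have "{i \<in> R. a i \<in> S} \<subseteq> p y ` (S - {y})" by force
    then have "card {i \<in> R. a i \<in> S} \<le> card (S - {y})"
      using finS by (meson card_image_le card_mono finite_Diff finite_imageI le_trans)
    then show ?thesis using y finS by (metis card_Diff1_less le_less_trans)
  qed
qed

text \<open>If \<open>S\<close> were proper, \<open>S\<close> and \<open>T - S\<close> would each
  have fewer edges than nodes, leaving at most \<open>card T - 2\<close> edges instead of
  \<open>card R\<close>.\<close>

lemma connected: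
  assumes "closed S" and "S \<noteq> {}"
  shows "S = T"
proof (rule ccontr)
  assume "S \<noteq> T"
  have S: "S \<subseteq> T" using assms by (simp add: closed_def)
  have S': "closed (T - S)" "T - S \<noteq> {}"
    using assms \<open>S \<noteq> T\<close> ends by (auto simp: closed_def)
  have "{i \<in> R. a i \<in> S} \<union> {i \<in> R. a i \<in> T - S} = R" using ends by auto
  then have "card R \<le> card {i \<in> R. a i \<in> S} + card {i \<in> R. a i \<in> T - S}"
    by (metis card_Un_le)
  moreover have "card T = card S + card (T - S)"
    using S finT by (metis card_Diff_subset card_mono finite_subset le_add_diff_inverse)
  ultimately show False
    using closed_few_labels[OF assms] closed_few_labels[OF S'] cardT by linarith
qed

text \<open>The nodes whose omission leaves label \<open>i\<close> at an end of edge
  \<open>i\<close> form a closed set containing \<open>a i\<close>, hence all of \<open>T\<close> by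
  connectedness.\<close>

lemma label_at_end:
  assumes i: "i \<in> R" and y: "y \<in> T" and l: "l \<in> T" "l \<noteq> y" "p y l = i"
  shows "l = a i \<or> l = b i"
proof -
  let ?H = "{z \<in> T. \<exists>l. (l = a i \<or> l = b i) \<and> l \<noteq> z \<and> p z l = i}"
  have "closed T" using ends by (auto simp: closed_def)
  moreover have "a i \<in> ?H" using i ends labels by force
  ultimately have "?H = T" using connected hits_closed[OF i] by blast
  then obtain l' where l': "l' = a i \<or> l' = b i" "l' \<noteq> y" "p y l' = i" using y by blast
  have "l' \<in> T" using l'(1) ends(1,2)[OF i] by blast
  then have "l' = l"
    using l l' bij[OF y] by (auto simp: bij_betw_def dest: inj_onD)
  then show ?thesis using l' by simp
qed

text \<open>By \<open>label_at_end\<close>, \<open>c\<close> and \<open>y\<close> are the two ends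
  of edge \<open>r\<close>, so omitting one or the other only changes which of them is matched to
  \<open>r\<close>.\<close>

lemma exchange:
  assumes r: "r \<in> R" and T: "x \<in> T" "c \<in> T" "y \<in> T" "c \<noteq> x" "y \<noteq> c"
    and l: "p x c = r" "p c y = r"
  shows "p y c = r" and "\<And>l. \<lbrakk>l \<in> T; l \<noteq> c; l \<noteq> y\<rbrakk> \<Longrightarrow> p y l = p c l"
proof -
  have "c = a r \<and> y = b r \<or> c = b r \<and> y = a r"
    using label_at_end[OF r] T l by metis
  then show "p y c = r" and "\<And>l. \<lbrakk>l \<in> T; l \<noteq> c; l \<noteq> y\<rbrakk> \<Longrightarrow> p y l = p c l"
    using labels agree r by auto
qed

text \<open>In the linkage tree rooted at \<open>x\<close>, take \<open>a'\<close> to be a topmost vertex of \<open>A\<close>: moving the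
  root to \<open>a'\<close> only changes the matching along the path from \<open>a'\<close> to \<open>x\<close>.\<close>

lemma topmost:
  assumes x: "x \<in> T" and A: "A \<subseteq> T - {x}" "A \<noteq> {}"
  shows "\<exists>a'\<in>A. \<forall>l\<in>A - {a'}. p a' l = p x l"
proof (rule ccontr)
  assume no: "\<not> ?thesis"
  \<comment> \<open>A step along an edge changes labels only at its two ends, and good nodes lie
    outside \<open>A\<close>. So the good nodes form a closed set, and it contains
    \<open>x\<close>.\<close>
  define Good where "Good = {y \<in> T. \<forall>l\<in>A - {y}. p y l = p x l}"
  have GA: "Good \<inter> A = {}" using no by (auto simp: Good_def)
  have "a i \<in> Good \<longleftrightarrow> b i \<in> Good" if i: "i \<in> R" for i
  proof -
    have "z' \<in> Good" if z: "z \<in> Good" and zz: "z = a i \<and> z' = b i \<or> z = b i \<and> z' = a i" for z z'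
    proof -
      have "z' \<in> T" using zz ends i by auto
      moreover have "p z' l = p x l" if l: "l \<in> A - {z'}" for l
      proof -
        have lz: "l \<noteq> z" using GA z l by auto
        have "l \<in> T" using l A by auto
        then have "p z' l = p z l" using agree[OF i, of l] zz lz l by auto
        then show ?thesis using z l lz by (auto simp: Good_def)
      qed
      ultimately show ?thesis by (auto simp: Good_def)
    qed
    then show ?thesis by blast
  qed
  then have "closed Good" by (auto simp: closed_def Good_def)
  moreover have "x \<in> Good" using x by (auto simp: Good_def)
  ultimately have "Good = T" using connected by blast
  then show False using GA A by auto
qed

end

section \<open>Pairwise compatibility of the matchings of a linkage field\<close>

locale linkage_system =
  fixes L :: "'l set" and R :: "'r set" and m :: "'l set \<Rightarrow> 'l \<Rightarrow> 'r"
  assumes finL: "finite L" and finR: "finite R"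
    and bij: "\<lbrakk>S \<subseteq> L; card S = card R\<rbrakk> \<Longrightarrow> bij_betw (m S) S R"
    and link: "\<lbrakk>i \<in> R; T \<subseteq> L; card T = Suc (card R)\<rbrakk> \<Longrightarrow> \<exists>a\<in>T. \<exists>b\<in>T. a \<noteq> b \<and>
      m (T - {a}) b = i \<and> m (T - {b}) a = i \<and> (\<forall>l\<in>T - {a, b}. m (T - {a}) l = m (T - {b}) l)"
begin

lemma linkage_graph:
  assumes T: "T \<subseteq> L" "card T = Suc (card R)"
  shows "\<exists>a b. linkage_graph T R (\<lambda>y. m (T - {y})) a b"
proof -
  have "\<exists>ab. fst ab \<in> T \<and> snd ab \<in> T \<and> fst ab \<noteq> snd ab \<and> m (T - {fst ab}) (snd ab) = i \<and>
      m (T - {snd ab}) (fst ab) = i \<and>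
      (\<forall>l\<in>T - {fst ab, snd ab}. m (T - {fst ab}) l = m (T - {snd ab}) l)" if "i \<in> R" for i
    using link[OF that T] by (metis fst_conv snd_conv)
  then obtain ab where ab: "\<And>i. i \<in> R \<Longrightarrow> fst (ab i) \<in> T \<and> snd (ab i) \<in> T \<and>
      fst (ab i) \<noteq> snd (ab i) \<and> m (T - {fst (ab i)}) (snd (ab i)) = i \<and>
      m (T - {snd (ab i)}) (fst (ab i)) = i \<and>
      (\<forall>l\<in>T - {fst (ab i), snd (ab i)}. m (T - {fst (ab i)}) l = m (T - {snd (ab i)}) l)"
    by metis
  have "linkage_graph T R (\<lambda>y. m (T - {y})) (\<lambda>i. fst (ab i)) (\<lambda>i. snd (ab i))"
  proof
    show "finite T" using T(1) finL finite_subset by blast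
    show "bij_betw (m (T - {y})) (T - {y}) R" if "y \<in> T" for y
      using bij[of "T - {y}"] T that by auto
  qed (use finR T ab in auto)
  then show ?thesis by blast
qed

text \<open>This starts the growth: \<open>label_at_end\<close> confines the label \<open>i\<close>
  to the two ends of edge \<open>i\<close>, which form the enlarged fibre.\<close>

lemma linked: "linked_field L R (\<lambda>_. 1) m"
proof -
  have "card (fibre S (m S) i) = 1" if S: "S \<subseteq> L" "card S = card R" and i: "i \<in> R" for S i
  proof -
    have "\<exists>!l. l \<in> S \<and> m S l = i"
      using bij[OF S] i by (auto simp: bij_betw_def inj_on_def)
    then have "\<exists>l. fibre S (m S) i = {l}" by (auto simp: fibre_def set_eq_iff) 
    then show ?thesis by auto
  qed
  moreover have "m S ` S \<subseteq> R" if "S \<subseteq> L" "card S = card R" for S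
    using bij[OF that] by (auto simp: bij_betw_def)
  moreover have "\<exists>g. extension (\<lambda>_. 1) m T i g"
    if T: "T \<subseteq> L" "card T = Suc (card R)" and i: "i \<in> R" for T i
  proof -
    obtain a b where "linkage_graph T R (\<lambda>y. m (T - {y})) a b" using linkage_graph[OF T] by blast
    then interpret linkage_graph T R "\<lambda>y. m (T - {y})" a b .
    note ei = ends[OF i] and li = labels[OF i]
    \<comment> \<open>The matching that omits \<open>a i\<close>, with \<open>a i\<close> hung on
      \<open>i\<close> next to \<open>b i\<close>.\<close>
    define g where "g = (m (T - {a i}))(a i := i)"
    have g_ends: "g (a i) = i" "g (b i) = i" using ei(3) li by (auto simp: g_def)
    have g_i: "l = a i \<or> l = b i" if "l \<in> T" "g l = i" for l
      using label_at_end[OF i ei(1) that(1)] that(2) by (cases "l = a i") (auto simp: g_def)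
    have "fibre T g i = {a i, b i}" using g_ends g_i ei by (auto simp: fibre_def)
    then have "card (fibre T g i) = 2" using ei(3) by simp
    moreover have "g l = i" if "j \<in> T" "l \<in> T - {j}" "m (T - {j}) l = i" for j l
    proof -
      have "l = a i \<or> l = b i" using label_at_end[OF i that(1), of l] that(2,3) by simp
      then show ?thesis using g_ends by blast
    qed
    moreover have "m (T - {j}) l = g l" if j: "j \<in> T" "g j = i" and l: "l \<in> T - {j}" for j l
    proof (cases "j = a i")
      case True
      then show ?thesis using l by (auto simp: g_def)
    next
      case False
      then have jb: "j = b i" using g_i[OF j] by simp
      show ?thesis
      proof (cases "l = a i")
        case True
        then show ?thesis using li(2) jb by (simp add: g_def)
      next
        case False
        then show ?thesis using agree[OF i, of l] l jb by (simp add: g_def)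
      qed
    qed
    ultimately show ?thesis unfolding extension_def by (intro exI[of _ g]) simp
  qed
  ultimately show ?thesis unfolding linked_field_def by simp
qed

text \<open>\<open>Q\<close> moves towards \<open>S\<close> by adding a node \<open>x\<close> of
  \<open>S\<close> and dropping a topmost node \<open>a\<close> of \<open>Q - S\<close>. The rest of
  \<open>Q - S\<close> keeps its partners, so a solution for the new set also serves
  \<open>Q\<close>. At the last step \<open>S + a - x\<close> is \<open>Q\<close> itself.\<close>

lemma single_exchange:
  assumes Q: "Q \<subseteq> L" "card Q = card R" and S: "S \<subseteq> L" "card S = card R" and "Q \<noteq> S"
  shows "\<exists>a\<in>Q - S. \<exists>b\<in>S - Q. m (insert a S - {b}) a = m Q a"
  using Q \<open>Q \<noteq> S\<close>
proof (induction "card (Q - S)" arbitrary: Q rule: less_induct)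
  case less
  have fin: "finite Q" "finite S" using less.prems(1) S(1) finL finite_subset by auto
  have ne: "Q - S \<noteq> {}" "S - Q \<noteq> {}"
    using card_subset_eq[OF fin(2), of Q] card_subset_eq[OF fin(1), of S] less.prems S by auto
  then obtain x where x: "x \<in> S" "x \<notin> Q" by blast
  define T where "T = insert x Q"
  have T: "T \<subseteq> L" "card T = Suc (card R)"
    using x S(1) less.prems fin by (auto simp: T_def)
  obtain u w where "linkage_graph T R (\<lambda>y. m (T - {y})) u w" using linkage_graph[OF T] by blast
  then interpret linkage_graph T R "\<lambda>y. m (T - {y})" u w .
  have Tx: "T - {x} = Q" using x by (auto simp: T_def)
  obtain a where a: "a \<in> Q - S" and keep: "\<And>l. \<lbrakk>l \<in> Q - S; l \<noteq> a\<rbrakk> \<Longrightarrow> m (T - {a}) l = m Q l"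
    using topmost[of x "Q - S"] ne x Tx by (auto simp: T_def)
  show ?case
  proof (cases "Q - S = {a}")
    case True
    have "card (S - Q) = card (Q - S)"
      using fin S(2) less.prems(2) by (simp add: card_Diff_subset_Int Int_commute)
    then have "card (S - Q) = 1" using True by simp
    then obtain z where "S - Q = {z}" by (rule card_1_singletonE)
    moreover have "x \<in> S - Q" using x by blast
    ultimately have "S - Q = {x}" by simp
    then have "insert a S - {x} = Q" using True by auto
    then show ?thesis using a x by auto
  next
    case False
    define Q1 where "Q1 = T - {a}"
    have Q1: "Q1 - S = Q - S - {a}" using x by (auto simp: Q1_def T_def)
    then have "card (Q1 - S) < card (Q - S)"
      using a fin by (metis card_Diff1_less finite_Diff)
    moreover have "Q1 \<subseteq> L" "card Q1 = card R" using T a by (auto simp: Q1_def T_def)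
    moreover have "Q1 \<noteq> S" using Q1 False a by blast
    ultimately obtain a1 b where ab: "a1 \<in> Q1 - S" "b \<in> S - Q1"
      "m (insert a1 S - {b}) a1 = m Q1 a1" using less.hyps by blast
    have "m Q1 a1 = m Q a1" using keep[of a1] ab(1) Q1 by (auto simp: Q1_def)
    moreover have "b \<in> S - Q" using ab(2) a by (auto simp: Q1_def T_def)
    ultimately show ?thesis using ab Q1 by auto
  qed
qed

text \<open>Keep \<open>S\<close> and move \<open>S'\<close> towards it. An exchange \<open>S' + a - b\<close> whose matching agrees with
  \<open>m S\<close> at \<open>a\<close> also shows that \<open>S' + a - y\<close>, where \<open>y\<close> is the partner of \<open>m S a\<close> in \<open>S'\<close>,
  carries the matching of \<open>S'\<close> with \<open>y\<close> replaced by \<open>a\<close>; this does not touch \<open>J\<close> and agrees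
  with \<open>m S\<close> at one more node.\<close>

lemma pairwise_compatible:
  assumes S: "S \<subseteq> L" "card S = card R" and S': "S' \<subseteq> L" "card S' = card R"
    and J: "J \<subseteq> S" "J \<subseteq> S'" "m S' ` J = m S ` J" and l: "l \<in> J"
  shows "m S' l = m S l"
  using S' J(2,3)
proof (induction "card {x \<in> S. \<not> (x \<in> S' \<and> m S' x = m S x)}" arbitrary: S' rule: less_induct)
  case less
  show ?case
  proof (cases "S = S'")
    case False
    obtain a b where a: "a \<in> S" "a \<notin> S'" and b: "b \<in> S'" "b \<notin> S"
      and ab: "m (insert a S' - {b}) a = m S a"
      using single_exchange[OF S less.prems(1,2) False] by blast
    define T where "T = insert a S'"
    have finS': "finite S'" using less.prems(1) finL finite_subset by blast
    have T: "T \<subseteq> L" "card T = Suc (card R)"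
      using a S(1) less.prems(1,2) finS' by (auto simp: T_def)
    obtain u w where "linkage_graph T R (\<lambda>y. m (T - {y})) u w" using linkage_graph[OF T] by blast
    then interpret linkage_graph T R "\<lambda>y. m (T - {y})" u w .
    define r where "r = m S a"
    have r: "r \<in> R" using linkage_system.bij[OF linkage_system_axioms S] a(1)
      by (auto simp: r_def bij_betw_def)
    have Ta: "T - {a} = S'" using a by (auto simp: T_def)
    have "r \<in> m S' ` S'"
      using linkage_system.bij[OF linkage_system_axioms less.prems(1,2)] r by (simp add: bij_betw_def)
    then obtain y where y: "y \<in> S'" "m S' y = r" by blast
    have inT: "b \<in> T" "a \<in> T" "y \<in> T" "a \<noteq> b" "y \<noteq> a" using a b y by (auto simp: T_def)
    \<comment> \<open>Omitting \<open>b\<close> matches \<open>a\<close> to \<open>r\<close>, and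
      omitting \<open>a\<close> matches \<open>y\<close> to \<open>r\<close>. So \<open>a\<close>
      and \<open>y\<close> are the ends of edge \<open>r\<close>, and \<open>y\<close> can leave in
      place of \<open>b\<close>.\<close>
    define S'' where "S'' = T - {y}"
    have lab: "m (T - {b}) a = r" "m (T - {a}) y = r" using ab y Ta by (simp_all add: T_def r_def)
    have ex: "m S'' a = r" "\<And>x. \<lbrakk>x \<in> S'; x \<noteq> y\<rbrakk> \<Longrightarrow> m S'' x = m S' x"
      using exchange[OF r inT lab] Ta a(2) by (auto simp: S''_def T_def)
    have injS: "inj_on (m S) S"
      using linkage_system.bij[OF linkage_system_axioms S] by (simp add: bij_betw_def)
    have yJ: "y \<notin> J"
    proof
      assume "y \<in> J"
      then have "r \<in> m S ` J" using y less.prems(4) by blast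
      then have "a \<in> J" using injS a(1) J(1) by (auto simp: r_def dest: inj_onD)
      then show False using a(2) less.prems(3) by blast
    qed
    have y_bad: "\<not> (y \<in> S \<and> m S' y = m S y)"
    proof
      assume "y \<in> S \<and> m S' y = m S y"
      then have "y = a" using injS a(1) y(2) by (auto simp: r_def dest: inj_onD)
      then show False using inT by simp
    qed
    have J'': "m S'' x = m S' x" if "x \<in> J" for x using ex(2)[of x] that yJ less.prems(3) by blast
    let ?D = "\<lambda>S'. {x \<in> S. \<not> (x \<in> S' \<and> m S' x = m S x)}"
    have "?D S'' \<subseteq> ?D S' - {a}"
    proof
      fix x assume x: "x \<in> ?D S''"
      have "x \<noteq> a" using x ex(1) inT by (auto simp: S''_def r_def)
      moreover have "\<not> (x \<in> S' \<and> m S' x = m S x)"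
      proof
        assume x': "x \<in> S' \<and> m S' x = m S x"
        then have "x \<noteq> y" using x y_bad by blast
        then show False using x x' ex(2)[of x] by (auto simp: S''_def T_def)
      qed
      ultimately show "x \<in> ?D S' - {a}" using x by blast
    qed
    then have "card (?D S'') < card (?D S')"
      using a S(1) finL finite_subset[OF S(1) finL]
      by (intro psubset_card_mono) auto
    moreover have "S'' \<subseteq> L" "card S'' = card R" using T inT by (auto simp: S''_def)
    moreover have "J \<subseteq> S''" using less.prems(3) yJ by (auto simp: S''_def T_def)
    moreover have "m S'' ` J = m S ` J" using J'' less.prems(4) by (simp cong: image_cong)
    ultimately have "m S'' l = m S l" using less.hyps by blast
    then show ?thesis using J''[OF l] by simp
  qed simp
qed

end

section \<open>Transversals and alternating cycles\<close>

lemma extend_transversal: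
  assumes "J \<subseteq> L" and "inj_on f J" and "f ` L = R"
  obtains S where "J \<subseteq> S" "S \<subseteq> L" "bij_betw f S R"
proof
  let ?c = "inv_into L f"
  let ?S = "J \<union> ?c ` (R - f ` J)"
  have c: "?c r \<in> L" "f (?c r) = r" if "r \<in> R" for r
    using that assms(3) inv_into_into[of r f L] f_inv_into_f[of r f L] by auto
  show "J \<subseteq> ?S" by simp
  show "?S \<subseteq> L" using assms(1) c by auto
  have "(\<lambda>r. f (?c r)) ` (R - f ` J) = (\<lambda>r. r) ` (R - f ` J)"
    by (rule image_cong) (use c in auto)
  then have fc: "f ` ?c ` (R - f ` J) = R - f ` J" by (simp add: image_image)
  have "inj_on (f \<circ> ?c) (R - f ` J)" using c(2) by (intro inj_onI) simp
  then have "inj_on f (?c ` (R - f ` J))" by (rule inj_on_imageI)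
  then have "inj_on f ?S" using assms(2) fc unfolding inj_on_Un by blast
  moreover have "f ` ?S = R" using fc assms(1,3) by (simp add: image_Un) blast
  ultimately show "bij_betw f ?S R" by (simp add: bij_betw_def)
qed

text \<open>A cycle of the multigraph on \<open>R\<close> with edges \<open>f l \<rightarrow> g l\<close>: in a minimal nonempty \<open>J\<close>
  with \<open>g ` J \<subseteq> f ` J\<close> every node of \<open>f ` J\<close> is entered and left exactly once.\<close>

lemma alternating_cycle:
  fixes f g :: "'l \<Rightarrow> 'r"
  assumes fin: "finite L" and card: "\<And>r. card (fibre L f r) = card (fibre L g r)"
    and l: "l \<in> L" "f l \<noteq> g l"
  obtains J where "J \<subseteq> L" "J \<noteq> {}" "inj_on f J" "inj_on g J" "f ` J = g ` J"
    "\<And>x. x \<in> J \<Longrightarrow> f x \<noteq> g x"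
proof -
  define D where "D = {x \<in> L. f x \<noteq> g x}"
  define P where "P J \<longleftrightarrow> J \<subseteq> D \<and> J \<noteq> {} \<and> g ` J \<subseteq> f ` J" for J
  \<comment> \<open>The fibres over \<open>g x\<close> have equal size and \<open>x\<close> lies
    only in that of \<open>g\<close>, so some \<open>y\<close> lies only in that of
    \<open>f\<close>.\<close>
  have "g x \<in> f ` D" if x: "x \<in> D" for x
  proof -
    have "x \<in> fibre L g (g x) - fibre L f (g x)" using x by (auto simp: D_def fibre_def)
    then have "\<not> fibre L f (g x) \<subseteq> fibre L g (g x)"
      using card_subset_eq[of "fibre L g (g x)" "fibre L f (g x)"] card[of "g x"] fin
      by (auto simp: fibre_def)
    then obtain y where "y \<in> L" "f y = g x" "g y \<noteq> g x" by (auto simp: fibre_def)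
    then show ?thesis by (auto simp: D_def intro!: image_eqI[of _ _ y])
  qed
  then have "P D" using l by (auto simp: P_def D_def)
  then obtain J where J: "P J" and min: "\<And>J'. P J' \<Longrightarrow> card J \<le> card J'"
    using ex_has_least_nat[of P D card] by blast
  have finJ: "finite J" using J fin by (auto simp: P_def D_def intro: finite_subset)
  have minimal: "J' = J" if "J' \<subseteq> J" "P J'" for J'
    using card_seteq[OF finJ that(1) min[OF that(2)]] .
  have "inj_on f J"
  proof (rule inj_onI, rule ccontr)
    fix x y assume xy: "x \<in> J" "y \<in> J" "f x = f y" "x \<noteq> y"
    have "f ` (J - {x}) = f ` J" using xy by (auto simp: image_iff)
    then have "P (J - {x})" using J xy by (auto simp: P_def)
    then show False using minimal[of "J - {x}"] xy by blast
  qed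
  moreover have "f ` J = g ` J"
  proof -
    \<comment> \<open>Dropping the nodes whose \<open>f\<close>-value is never entered by
      \<open>g\<close> keeps the property \<open>P\<close>, so minimality leaves none of
      them.\<close>
    let ?J = "{x \<in> J. f x \<in> g ` J}"
    have "f ` ?J = f ` J \<inter> g ` J" by blast
    then have fJ: "f ` ?J = g ` J" using J by (auto simp: P_def)
    have JD: "J \<subseteq> D" "J \<noteq> {}" using J by (simp_all add: P_def)
    have "?J \<noteq> {}" using fJ JD(2) by (metis image_is_empty)
    moreover have "g ` ?J \<subseteq> f ` ?J" unfolding fJ by blast
    ultimately have "P ?J" using JD(1) unfolding P_def by blast
    then have "?J = J" by (intro minimal) auto
    then show ?thesis using fJ by simp
  qed
  moreover have "inj_on g J"
    using calculation card_image[of f J] finJ by (metis eq_card_imp_inj_on)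
  ultimately show ?thesis using J that by (auto simp: P_def D_def)
qed

section \<open>Topes and matchings as graphs of maps\<close>

abbreviation graph :: "(nat \<Rightarrow> nat) \<Rightarrow> nat set \<Rightarrow> bgraph" where
  "graph f A \<equiv> (\<lambda>l. (l, f l)) ` A"

lemma perfect_matching_graph: "bij_betw f J I \<Longrightarrow> perfect_matching J I (graph f J)"
  by (auto simp: perfect_matching_def bij_betw_def inj_on_def)

lemma perfect_matching_in_graph:
  assumes "perfect_matching J I P" and "P \<subseteq> graph f A"
  shows "J \<subseteq> A" "bij_betw f J I" "P = graph f J"
proof -
  have P: "P \<subseteq> J \<times> I" "\<And>j. j \<in> J \<Longrightarrow> \<exists>!i. (j, i) \<in> P" "\<And>i. i \<in> I \<Longrightarrow> \<exists>!j. (j, i) \<in> P"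
    using assms(1) by (auto simp: perfect_matching_def)
  have f: "j \<in> A" "(j, f j) \<in> P" if "j \<in> J" for j
    using P(2)[OF that] assms(2) by auto
  then show "J \<subseteq> A" by blast
  show gr: "P = graph f J"
  proof
    show "P \<subseteq> graph f J" using P(1) assms(2) by fastforce
    show "graph f J \<subseteq> P" using f(2) by auto
  qed
  have "inj_on f J"
  proof (rule inj_onI)
    fix x y assume "x \<in> J" "y \<in> J" "f x = f y"
    then show "x = y" using f(2)[of x] f(2)[of y] P(1) P(3)[of "f x"]
      by (metis SigmaD2 subsetD)
  qed
  moreover have "f ` J \<subseteq> I" using f(2) P(1) by blast
  moreover have "i \<in> f ` J" if i: "i \<in> I" for i
  proof -
    obtain j where "(j, i) \<in> P" using P(3)[OF i] by blast
    then show ?thesis unfolding gr by auto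
  qed
  ultimately show "bij_betw f J I" unfolding bij_betw_def by blast
qed

lemma perfect_matching_function:
  assumes "perfect_matching J I P"
  shows "\<exists>f. bij_betw f J I \<and> P = graph f J"
proof -
  define f where "f j = (THE i. (j, i) \<in> P)" for j
  have "P \<subseteq> graph f J"
  proof
    fix e assume e: "e \<in> P"
    obtain j i where ji: "e = (j, i)" by fastforce
    have j: "j \<in> J" "\<exists>!i. (j, i) \<in> P" using assms e ji by (auto simp: perfect_matching_def)
    then have "f j = i" using e ji unfolding f_def by (intro the1_equality) auto
    then show "e \<in> graph f J" using j ji by auto
  qed
  then show ?thesis using perfect_matching_in_graph[OF assms] by blast
qed

text \<open>A perfect matching inside the graph of a map is the restriction of that map to a set on
  which it is injective.\<close>

lemma compatible_graphs:
  assumes "A \<subseteq> Lnodes n" and "f ` A \<subseteq> Rnodes d"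
  shows "compatible n d (graph f A) (graph g B) \<longleftrightarrow>
    (\<forall>J\<subseteq>A \<inter> B. inj_on f J \<longrightarrow> inj_on g J \<longrightarrow> f ` J = g ` J \<longrightarrow> (\<forall>l\<in>J. f l = g l))"
    (is "?C \<longleftrightarrow> ?P")
proof
  assume C: ?C
  have "f l = g l" if J: "J \<subseteq> A \<inter> B" "inj_on f J" "inj_on g J" "f ` J = g ` J" "l \<in> J" for J l
  proof -
    have pm: "perfect_matching J (f ` J) (graph f J)" "perfect_matching J (f ` J) (graph g J)"
      using J by (auto intro!: perfect_matching_graph simp: bij_betw_def)
    have JI: "J \<subseteq> Lnodes n" "f ` J \<subseteq> Rnodes d" using J(1) assms by auto
    have sub: "graph f J \<subseteq> graph f A" "graph g J \<subseteq> graph g B" using J(1) by auto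
    have "graph f J = graph g J"
      by (rule C[unfolded compatible_def, rule_format, OF JI sub(1) pm(1) sub(2) pm(2)])
    then have "(l, f l) \<in> graph g J" using J(5) by blast
    then show ?thesis by auto
  qed
  then show ?P by blast
next
  assume P: ?P
  show ?C unfolding compatible_def
  proof (intro allI impI)
    fix J I P1 P2
    assume a: "P1 \<subseteq> graph f A" "perfect_matching J I P1" "P2 \<subseteq> graph g B" "perfect_matching J I P2"
    note f = perfect_matching_in_graph[OF a(2,1)] and g = perfect_matching_in_graph[OF a(4,3)]
    have "\<forall>l\<in>J. f l = g l" using P f g by (simp add: bij_betw_def)
    then show "P1 = P2" using f(3) g(3) by (simp cong: image_cong)
  qed
qed

lemma rdeg_graph: "rdeg (graph f A) r = card (fibre A f r)"
proof -
  have "{l. (l, r) \<in> graph f A} = fibre A f r" by (auto simp: fibre_def)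
  then show ?thesis by (simp add: rdeg_def)
qed

lemma maximal_tope_graph:
  "maximal_tope n d (graph f (Lnodes n)) \<longleftrightarrow>
    f ` Lnodes n \<subseteq> Rnodes d \<and> (\<forall>r\<in>Rnodes d. card (fibre (Lnodes n) f r) > 0)"
proof -
  have "{r. (l, r) \<in> graph f (Lnodes n)} = {f l}" if "l \<in> Lnodes n" for l
    using that by auto
  then have "\<forall>l\<in>Lnodes n. ldeg (graph f (Lnodes n)) l = 1" by (simp add: ldeg_def)
  then show ?thesis by (auto simp: maximal_tope_def is_graph_def rdeg_graph)
qed

lemma maximal_tope_function:
  assumes "maximal_tope n d G"
  shows "\<exists>f. G = graph f (Lnodes n)"
proof -
  define f where "f l = (THE r. (l, r) \<in> G)" for l
  have G: "G \<subseteq> Lnodes n \<times> Rnodes d" "\<And>l. l \<in> Lnodes n \<Longrightarrow> card {r. (l, r) \<in> G} = 1"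
    using assms by (auto simp: maximal_tope_def is_graph_def ldeg_def)
  have f: "(l, r) \<in> G \<longleftrightarrow> r = f l" if l: "l \<in> Lnodes n" for l r
  proof -
    obtain s where s: "{r. (l, r) \<in> G} = {s}" using G(2)[OF l] by (rule card_1_singletonE)
    then have "f l = s" unfolding f_def by blast
    then show ?thesis using s by blast
  qed
  then have "G = graph f (Lnodes n)" using G(1) by auto
  then show ?thesis by blast
qed

text \<open>The node \<open>b\<close> is covered by the matching on \<open>T - {a}\<close> but not
  by the one on \<open>T - {b}\<close>, so its edge must be one of those ignored, at
  \<open>i\<close>; likewise for \<open>a\<close>. Injectivity keeps all other nodes away from
  \<open>i\<close>, where the two matchings agree.\<close>

lemma linkage_system_of_linkage:
  assumes link: "linkage n d M"
  obtains m where "linkage_system (Lnodes n) (Rnodes d) m"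
    "\<And>S. \<lbrakk>S \<subseteq> Lnodes n; card S = d\<rbrakk> \<Longrightarrow> M S = graph (m S) S"
proof -
  have cR: "card (Rnodes d) = d" by (simp add: Rnodes_def)
  have "\<exists>f. bij_betw f S (Rnodes d) \<and> M S = graph f S" if "S \<subseteq> Lnodes n" "card S = d" for S
  proof -
    have "perfect_matching S (Rnodes d) (M S)"
      using link that unfolding linkage_def matching_field_def by simp
    then show ?thesis by (rule perfect_matching_function)
  qed
  then obtain m where m: "bij_betw (m S) S (Rnodes d)" "M S = graph (m S) S"
    if "S \<subseteq> Lnodes n" "card S = d" for S by metis
  have "linkage_system (Lnodes n) (Rnodes d) m"
  proof
    show "finite (Lnodes n)" "finite (Rnodes d)" by (simp_all add: Lnodes_def Rnodes_def)
    show "bij_betw (m S) S (Rnodes d)" if "S \<subseteq> Lnodes n" "card S = card (Rnodes d)" for S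
      using m that cR by simp
    fix i T assume i: "i \<in> Rnodes d" and T: "T \<subseteq> Lnodes n" "card T = Suc (card (Rnodes d))"
    then obtain a b where ab: "a \<in> T" "b \<in> T" "a \<noteq> b"
      and eq: "M (T - {a}) - {e. snd e = i} = M (T - {b}) - {e. snd e = i}"
      using link cR unfolding linkage_def by (metis Suc_eq_plus1)
    have sub: "T - {y} \<subseteq> Lnodes n" "card (T - {y}) = d" if "y \<in> T" for y
      using T that cR by auto
    have agree: "(l \<noteq> a \<and> m (T - {a}) l = r) \<longleftrightarrow> (l \<noteq> b \<and> m (T - {b}) l = r)"
      if "l \<in> T" "r \<noteq> i" for l r
    proof -
      have "(l, r) \<in> M (T - {a}) - {e. snd e = i} \<longleftrightarrow> (l, r) \<in> M (T - {b}) - {e. snd e = i}"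
        by (simp only: eq)
      then have "(l, r) \<in> M (T - {a}) \<longleftrightarrow> (l, r) \<in> M (T - {b})" using that(2) by simp
      then show ?thesis using m(2)[OF sub] ab that(1) by auto
    qed
    have "m (T - {a}) b = i" "m (T - {b}) a = i" using agree[OF ab(2)] agree[OF ab(1)] ab by auto
    moreover have "m (T - {a}) l = m (T - {b}) l" if l: "l \<in> T - {a, b}" for l
    proof -
      have "m (T - {a}) l \<noteq> i"
      proof
        assume "m (T - {a}) l = i"
        then have "l = b" using m(1)[OF sub[OF ab(1)]] calculation(1) l ab
          by (auto simp: bij_betw_def dest: inj_onD)
        then show False using l by simp
      qed
      then show ?thesis using agree[of l "m (T - {a}) l"] l by auto
    qed
    ultimately show "\<exists>a\<in>T. \<exists>b\<in>T. a \<noteq> b \<and> m (T - {a}) b = i \<and> m (T - {b}) a = i \<and>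
        (\<forall>l\<in>T - {a, b}. m (T - {a}) l = m (T - {b}) l)"
      using ab by blast
  qed
  then show ?thesis using m(2) that by blast
qed

theorem theorem3p16:
  fixes n d :: nat and M :: "nat set \<Rightarrow> bgraph" and v :: "nat \<Rightarrow> nat"
  assumes "d \<le> n"
    and "linkage n d M"
    and "\<forall>i<d. v i > 0"
    and "(\<Sum>i<d. v i) = n"
  shows "\<exists>!G. maximal_tope n d G \<and> (\<forall>i<d. rdeg G i = v i) \<and> compatible_with_MF n d M G"
proof -
  let ?L = "Lnodes n" and ?R = "Rnodes d"
  have R: "?R = {..<d}" "card ?R = d" and cL: "card ?L = n"
    by (auto simp: Rnodes_def Lnodes_def)
  obtain m where ls: "linkage_system ?L ?R m"
    and M: "\<And>S. \<lbrakk>S \<subseteq> ?L; card S = d\<rbrakk> \<Longrightarrow> M S = graph (m S) S"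
    using linkage_system_of_linkage[OF assms(2)] by blast
  interpret linkage_system ?L ?R m by (rule ls)
  have compat: "compatible_with_MF n d M (graph f ?L) \<longleftrightarrow>
    (\<forall>S. S \<subseteq> ?L \<and> card S = d \<longrightarrow> (\<forall>J\<subseteq>S. inj_on f J \<longrightarrow> inj_on (m S) J \<longrightarrow>
      f ` J = m S ` J \<longrightarrow> (\<forall>l\<in>J. f l = m S l)))" if "f ` ?L \<subseteq> ?R" for f
  proof -
    have "compatible n d (graph f ?L) (M S) \<longleftrightarrow> (\<forall>J\<subseteq>S. inj_on f J \<longrightarrow> inj_on (m S) J \<longrightarrow>
        f ` J = m S ` J \<longrightarrow> (\<forall>l\<in>J. f l = m S l))" if "S \<subseteq> ?L" "card S = d" for S
    proof -
      have "?L \<inter> S = S" using that(1) by blast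
      then show ?thesis using compatible_graphs[OF order_refl \<open>f ` ?L \<subseteq> ?R\<close>, of "m S" S] M[OF that]
        by simp
    qed
    then show ?thesis unfolding compatible_with_MF_def by simp
  qed
  have onto: "f ` ?L = ?R"
    if "f ` ?L \<subseteq> ?R" "\<forall>r\<in>?R. card (fibre ?L f r) = v r" for f
  proof
    show "?R \<subseteq> f ` ?L"
    proof
      fix r assume r: "r \<in> ?R"
      then have "fibre ?L f r \<noteq> {}" using that(2) assms(3) R(1) by fastforce
      then show "r \<in> f ` ?L" by (auto simp: fibre_def)
    qed
  qed (rule that(1))
  have sumv: "sum v ?R = n" using assms(4) R(1) by simp
  obtain F where F: "linked_field ?L ?R v F"
    and trans: "\<And>T S l. \<lbrakk>T \<subseteq> ?L; card T = sum v ?R; S \<subseteq> T; card S = card ?R; inj_on (F T) S; l \<in> S\<rbrakk>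
      \<Longrightarrow> m S l = F T l"
    using linked_field_exists[OF finL finR linked, of v] assms(3) R(1)
    by (metis One_nat_def Suc_leI lessThan_iff)
  define f where "f = F ?L"
  have f: "f ` ?L \<subseteq> ?R" "\<forall>r\<in>?R. card (fibre ?L f r) = v r"
    using F sumv cL unfolding linked_field_def f_def by simp_all
  have fm: "f l = m S l"
    if S: "S \<subseteq> ?L" "card S = d" "J \<subseteq> S" and J: "inj_on f J" "f ` J = m S ` J" "l \<in> J" for S J l
  proof -
    \<comment> \<open>On a transversal \<open>S'\<close> of \<open>f\<close> the matching of the
      field is \<open>f\<close> itself, so comparing \<open>f\<close> with \<open>m S\<close> on
      \<open>J\<close> becomes a comparison of two matchings of the field.\<close>
    obtain S' where S': "J \<subseteq> S'" "S' \<subseteq> ?L" "bij_betw f S' ?R"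
      using extend_transversal[OF _ J(1) onto[OF f], of thesis] S by blast
    have c: "card S' = card ?R" using bij_betw_same_card[OF S'(3)] .
    have eq: "m S' x = f x" if "x \<in> S'" for x
      using trans[OF order_refl, of S' x] S' c that cL sumv by (simp add: f_def bij_betw_def)
    then have "m S' ` J = m S ` J" using J(2) S'(1) by (metis image_cong subsetD)
    then have "m S' l = m S l"
      using pairwise_compatible[OF S(1) _ S'(2) c S(3) S'(1) _ J(3)] S(2) R(2) by simp
    then show ?thesis using eq S'(1) J(3) by auto
  qed
  have f_compat: "compatible_with_MF n d M (graph f ?L)"
    unfolding compat[OF f(1)] by (intro allI impI ballI) (elim conjE, rule fm)
  have ex: "maximal_tope n d (graph f ?L) \<and> (\<forall>i<d. rdeg (graph f ?L) i = v i) \<and>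
      compatible_with_MF n d M (graph f ?L)"
    using f f_compat assms(3) R(1) by (auto simp: maximal_tope_graph rdeg_graph)
  have uniq: "graph g ?L = graph f ?L"
    if g: "g ` ?L \<subseteq> ?R" "\<forall>r\<in>?R. card (fibre ?L g r) = v r"
      and g_compat: "compatible_with_MF n d M (graph g ?L)" for g
  proof (rule ccontr)
    assume "graph g ?L \<noteq> graph f ?L"
    then obtain l where l: "l \<in> ?L" "f l \<noteq> g l" by (metis (no_types, lifting) image_cong)
    have cards: "card (fibre ?L f r) = card (fibre ?L g r)" for r
    proof (cases "r \<in> ?R")
      case False
      then have "fibre ?L f r = {}" "fibre ?L g r = {}" using f(1) g(1) by (auto simp: fibre_def)
      then show ?thesis by simp
    qed (use f g in simp)
    obtain J where J: "J \<subseteq> ?L" "J \<noteq> {}" "inj_on f J" "inj_on g J" "f ` J = g ` J"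
      "\<And>x. x \<in> J \<Longrightarrow> f x \<noteq> g x"
      using alternating_cycle[where f = f and g = g, OF finL cards l] by metis
    \<comment> \<open>Compatibility of \<open>f\<close> gives \<open>f = m S\<close> on all of
      \<open>S\<close>. On the cycle \<open>J\<close>, \<open>g\<close> and \<open>m S\<close> then
      have the same image, and compatibility of \<open>g\<close> forces \<open>g = f\<close>
      there.\<close>
    obtain S where S: "J \<subseteq> S" "S \<subseteq> ?L" "bij_betw f S ?R"
      using extend_transversal[OF J(1,3) onto[OF f]] by blast
    have c: "card S = d" using bij_betw_same_card[OF S(3)] R(2) by simp
    have b: "bij_betw (m S) S ?R" using bij[OF S(2)] c R(2) by simp
    have eq: "f x = m S x" if "x \<in> S" for x
      using f_compat[unfolded compat[OF f(1)], rule_format, of S S x] S b c that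
      by (simp add: bij_betw_def)
    have "m S ` J = g ` J" using eq J(5) S(1) by (metis image_cong subsetD)
    moreover have "inj_on (m S) J" using b S(1) inj_on_subset by (auto simp: bij_betw_def)
    ultimately have "g x = m S x" if "x \<in> J" for x
      using g_compat[unfolded compat[OF g(1)], rule_format, of S J x] S(1,2) c J(4) that by simp
    then show False using J(2,6) eq S(1) by (metis all_not_in_conv subsetD)
  qed
  show ?thesis
  proof (rule ex1I[of _ "graph f ?L"])
    show "maximal_tope n d (graph f ?L) \<and> (\<forall>i<d. rdeg (graph f ?L) i = v i) \<and>
      compatible_with_MF n d M (graph f ?L)" by (rule ex)
  next
    fix G assume G: "maximal_tope n d G \<and> (\<forall>i<d. rdeg G i = v i) \<and> compatible_with_MF n d M G"
    then obtain g where "G = graph g ?L" using maximal_tope_function by blast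
    then show "G = graph f ?L"
      using uniq[of g] G R(1) by (simp add: maximal_tope_graph rdeg_graph)
  qed
qed

end
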